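(* Assume that there are constants $L>0$, $\rho_0>0$ with $\|G_u\|_{\mathbb{L}(U,Y)}\le L$ for all $u\in\overline B_U(u^\dag,\rho_0)$, and constants $\rho\in(0,\rho_0]$ and $\mu\in[0,1)$ with $$\|F(\hat u)-F(u)-G_u(\hat u-u)\|_Y\le\mu\|F(\hat u)-F(u)\|_Y\quad\text{for all }u,\hat u\in\overline B_U(u^\dag,\rho).$$ Let $\Lambda\ge\lambda>0$ satisfy $2-2\mu-\Lambda L^2>0$. Then for any starting point $u_0\in\overline B_U(u^\dag,\rho)$ and step sizes $\{w_n\}_{n\in\mathbb N}\subset[\lambda,\Lambda]$, the modified Landweber iteration with exact data ($\delta=0$) $$u_{n+1}=u_n+w_nG_{u_n}^*(y^\dag-F(u_n)),\quad n\ge0,$$ either stops after finitely many iterations with an iterate coinciding with an element of $S(u^\dag,\rho)$, or generates a sequence of iterates that converges strongly in $U$ to an element of $S(u^\dag,\rho)$.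
   Context: $U,Y$ are real Hilbert spaces, $F:U\to Y$ is a mapping, $u^\dag\in U$ and $y^\dag=F(u^\dag)$. $\overline B_U(u,\rho)$ is the closed ball in $U$ of radius $\rho$ centered at $u$, and $S(u^\dag,\rho):=\{u\in\overline B_U(u^\dag,\rho):F(u)=y^\dag\}$. $\mathbb{L}(U,Y)$ is the space of bounded linear operators. $u\mapsto G_u\in\mathbb{L}(U,Y)$ is a given mapping on $U$ (not assumed continuous), and $G_u^*\in\mathbb{L}(Y,U)$ is the Hilbert space adjoint. For exact data ($\delta=0$) the stopping rule (discrepancy principle) stops the iteration at the first index $N$, if any, with $F(u_N)=y^\dag$. *)

theory Defs
  imports "HOL-Analysis.Analysis"
begin

definition solution_set :: "('u::metric_space \<Rightarrow> 'y) \<Rightarrow> 'y \<Rightarrow> 'u \<Rightarrow> real \<Rightarrow> 'u set" where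
  "solution_set F y v r = {u \<in> cball v r. F u = y}"

text \<open>
  The library constant \<^const>\<open>adjoint\<close> selects a function \<open>f'\<close> with
  \<open>\<forall>x y. f x \<bullet> y = x \<bullet> f' y\<close>. For a bounded operator between Hilbert spaces such a function
  exists, is unique and is bounded linear, so it is the Hilbert space adjoint.

  The recursion is defined for all indices. If an iterate satisfies \<open>F u = y\<close>, all later
  iterates coincide with it, as the adjoint maps \<open>0\<close> to \<open>0\<close>; the iterates computed up to the
  stopping index are therefore those of the stopped iteration.
\<close>

primrec landweber ::
  "('u::{real_inner,complete_space} \<Rightarrow> 'y::{real_inner,complete_space}) \<Rightarrow>
   ('u \<Rightarrow> 'u \<Rightarrow>\<^sub>L 'y) \<Rightarrow> 'y \<Rightarrow> (nat \<Rightarrow> real) \<Rightarrow> 'u \<Rightarrow> nat \<Rightarrow> 'u" where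
  "landweber F G y w u0 0 = u0"
| "landweber F G y w u0 (Suc n) =
     landweber F G y w u0 n
     + w n *\<^sub>R adjoint (blinfun_apply (G (landweber F G y w u0 n)))
                 (y - F (landweber F G y w u0 n))"

text \<open>The discrepancy principle for noise level \<open>0\<close>: \<open>N\<close> is the first index with zero residual.\<close>

definition stops_at :: "('u \<Rightarrow> 'y) \<Rightarrow> 'y \<Rightarrow> (nat \<Rightarrow> 'u) \<Rightarrow> nat \<Rightarrow> bool" where
  "stops_at F y u N \<longleftrightarrow> F (u N) = y \<and> (\<forall>n<N. F (u n) \<noteq> y)"

end

theory Submission
  imports Defs
begin

text \<open>
  Write \<open>r\<^sub>n\<close> for the residual \<open>y - F u\<^sub>n\<close> and \<open>a\<^sub>n\<close> for the squared error
  \<open>\<parallel>u\<^sub>n - u_dag\<parallel>\<^sup>2\<close>. The tangential cone condition says that \<open>G u\<^sub>n (u_dag - u\<^sub>n)\<close> is the residual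
  up to a relative error \<open>\<mu> < 1\<close>. Hence the update, whose inner product with
  \<open>u_dag - u\<^sub>n\<close> is \<open>w\<^sub>n\<close> times that of \<open>r\<^sub>n\<close> with
  \<open>G u\<^sub>n (u_dag - u\<^sub>n)\<close>, makes an acute angle with \<open>u_dag - u\<^sub>n\<close> if
  \<open>r\<^sub>n \<noteq> 0\<close>, and the step size bound keeps it from overshooting: \<open>a\<^sub>n\<close> drops by at least a constant multiple of \<open>\<parallel>r\<^sub>n\<parallel>\<^sup>2\<close> (\<open>error_decrease\<close>). So the iterates
  never leave the ball, \<open>a\<close> converges, and the sum of all \<open>\<parallel>r\<^sub>n\<parallel>\<^sup>2\<close> is finite.

  This alone gives no strong convergence, because \<open>u_dag\<close> need not be the limit. To compare \<open>u\<^sub>m\<close>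
  with \<open>u\<^sub>n\<close> one passes through the iterate \<open>u\<^sub>l\<close>, \<open>m \<le> l \<le> n\<close>, with the smallest residual among \<open>u\<^sub>m, \<dots>, u\<^sub>n\<close>.
  The inner product of \<open>u\<^sub>j - u\<^sub>l\<close> with \<open>u_dag - u\<^sub>l\<close> is a sum over the steps
  between \<open>j\<close> and \<open>l\<close>; in the \<open>i\<close>-th summand the cone condition at \<open>u\<^sub>i\<close>
  bounds \<open>G u\<^sub>i (u_dag - u\<^sub>l)\<close> by a multiple of \<open>\<parallel>r\<^sub>i\<parallel>\<close>, by the minimality of
  \<open>\<parallel>r\<^sub>l\<parallel>\<close>. The inner product is then at most a multiple of the sum of the squared residuals, that
  is, of \<open>a\<^sub>m - a\<^sub>n\<close> (\<open>dist_square_le_error_drop\<close>). Since \<open>a\<close> is a Cauchy sequence, so is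
  \<open>u\<close>. The cone condition also makes \<open>F\<close> Lipschitz on the ball, so the residual at the limit is
  the limit of the residuals, namely \<open>0\<close>.

  The adjoint is a choice operator, so its existence in infinite dimensions has to be established
  first; this is the Riesz representation theorem, obtained by minimising
  \<open>\<parallel>x\<parallel>\<^sup>2 - 2 f x\<close>.
\<close>

section \<open>The adjoint of a bounded operator between Hilbert spaces\<close>

text \<open>
  The functional \<open>J x = \<parallel>x\<parallel>\<^sup>2 - 2 f x\<close> is bounded below, and by the parallelogram law
  \<open>\<parallel>x - y\<parallel>\<^sup>2 = 2 J x + 2 J y - 4 J ((x + y) / 2)\<close>; so every minimising sequence is Cauchy. At
  the minimiser \<open>z\<close> the first variation \<open>2 (z \<bullet> h - f h)\<close> vanishes.
\<close>

theorem riesz_representation: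
  fixes f :: "'a::{real_inner,complete_space} \<Rightarrow> real"
  assumes "bounded_linear f"
  shows "\<exists>z. \<forall>x. f x = x \<bullet> z"
proof -
  interpret f: bounded_linear f by fact
  define J where "J x = x \<bullet> x - 2 * f x" for x
  define m where "m = (INF x. J x)"
  obtain K where K: "\<And>x. \<bar>f x\<bar> \<le> norm x * K"
    using f.bounded by (auto simp: mult.commute)
  have "- K\<^sup>2 \<le> J x" for x
  proof -
    have "0 \<le> (norm x - K)\<^sup>2" by simp
    moreover have "f x \<le> norm x * K" using K[of x] by linarith
    ultimately show ?thesis
      unfolding J_def by (simp add: dot_square_norm power2_diff)
  qed
  then have bdd: "bdd_below (range J)" by (rule bdd_belowI2)
  have m_le: "m \<le> J x" for x
    unfolding m_def using bdd by (auto intro: cINF_lower)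
  have "\<exists>x. J x < m + inverse (Suc n)" for n
    using cINF_less_iff[of UNIV J "m + inverse (Suc n)"] bdd
    by (auto simp: m_def)
  then obtain x where x: "\<And>n. J (x n) < m + inverse (Suc n)" by metis
  have par: "(norm (a - b))\<^sup>2 \<le> 2 * (J a - m) + 2 * (J b - m)" for a b
  proof -
    have "(norm (a - b))\<^sup>2 = 2 * J a + 2 * J b - 4 * J ((1/2) *\<^sub>R (a + b))"
      unfolding J_def power2_norm_eq_inner
      by (simp add: f.add f.scaleR algebra_simps inner_commute)
    with m_le[of "(1/2) *\<^sub>R (a + b)"] show ?thesis by simp
  qed
  have "Cauchy x"
  proof (rule metric_CauchyI)
    fix e :: real assume "e > 0"
    then obtain N where N: "inverse (real (Suc N)) < e\<^sup>2 / 4"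
      using reals_Archimedean[of "e\<^sup>2 / 4"] by auto
    have near: "J (x i) - m < e\<^sup>2 / 4" if "i \<ge> N" for i
    proof -
      have "inverse (real (Suc i)) \<le> inverse (real (Suc N))"
        using that by (intro le_imp_inverse_le) auto
      then have "J (x i) < m + e\<^sup>2 / 4"
        using x[of i] N by (meson add_left_mono le_less_trans less_le_trans less_imp_le)
      then show ?thesis by simp
    qed
    show "\<exists>M. \<forall>i\<ge>M. \<forall>j\<ge>M. dist (x i) (x j) < e"
    proof (intro exI allI impI)
      fix i j assume "i \<ge> N" "j \<ge> N"
      then have "(norm (x i - x j))\<^sup>2 < e\<^sup>2"
        using par[of "x i" "x j"] near[of i] near[of j] by argo
      then show "dist (x i) (x j) < e"
        using \<open>e > 0\<close> by (simp add: dist_norm power2_less_imp_less)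
    qed
  qed
  then obtain z where z: "x \<longlonglongrightarrow> z"
    using Cauchy_convergent convergent_def by blast
  have "(\<lambda>n. J (x n)) \<longlonglongrightarrow> J z"
    unfolding J_def by (intro tendsto_intros z f.tendsto)
  moreover have "(\<lambda>n. m + inverse (real (Suc n))) \<longlonglongrightarrow> m + 0"
    by (intro tendsto_add tendsto_const LIMSEQ_inverse_real_of_nat)
  ultimately have "J z \<le> m + 0"
    by (rule LIMSEQ_le) (intro exI allI impI less_imp_le x)
  then have Jz: "J z \<le> J y" for y using m_le[of y] by simp
  have "f h = h \<bullet> z" for h
  proof -
    define d where "d = f h - h \<bullet> z"
    have var: "J (z + t *\<^sub>R h) = J z - 2 * t * d + t\<^sup>2 * (h \<bullet> h)" for t
      unfolding J_def d_def
      by (simp add: f.add f.scaleR inner_commute power2_eq_square algebra_simps)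
    \<comment> \<open>Any \<open>t\<close> of the sign of \<open>d\<close> and small enough decreases \<open>J\<close>; adding \<open>1\<close> avoids
        the case \<open>h = 0\<close>.\<close>
    define t where "t = d / (h \<bullet> h + 1)"
    have pos: "h \<bullet> h + 1 > 0" by (simp add: add_nonneg_pos)
    then have td: "d = t * (h \<bullet> h + 1)" by (simp add: t_def)
    have "2 * t * d \<le> t\<^sup>2 * (h \<bullet> h)" using Jz[of "z + t *\<^sub>R h"] var[of t] by simp
    then have "t\<^sup>2 * (h \<bullet> h) + 2 * t\<^sup>2 \<le> 0"
      unfolding td by (simp add: power2_eq_square algebra_simps)
    moreover have "0 \<le> t\<^sup>2 * (h \<bullet> h)" by simp
    ultimately have "t\<^sup>2 \<le> 0" by linarith
    then show ?thesis using td by (simp add: d_def)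
  qed
  then show ?thesis by blast
qed

lemma inner_adjoint_blinfun:
  fixes A :: "'a::{real_inner,complete_space} \<Rightarrow>\<^sub>L 'b::real_inner"
  shows "x \<bullet> adjoint (blinfun_apply A) y = blinfun_apply A x \<bullet> y"
proof -
  have "bounded_linear (\<lambda>x. blinfun_apply A x \<bullet> y)" for y
    by (intro bounded_linear_inner_left_comp blinfun.bounded_linear_right)
  then have "\<exists>z. \<forall>x. blinfun_apply A x \<bullet> y = x \<bullet> z" for y
    by (rule riesz_representation)
  then have "\<exists>g. \<forall>x y. blinfun_apply A x \<bullet> y = x \<bullet> g y" by metis
  then have "\<forall>x y. blinfun_apply A x \<bullet> y = x \<bullet> adjoint (blinfun_apply A) y"
    unfolding adjoint_def by (rule someI_ex)
  then show ?thesis by metis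
qed

lemma norm_adjoint_blinfun_le:
  fixes A :: "'a::{real_inner,complete_space} \<Rightarrow>\<^sub>L 'b::real_inner"
  shows "norm (adjoint (blinfun_apply A) y) \<le> norm A * norm y"
proof -
  let ?z = "adjoint (blinfun_apply A) y"
  have "norm ?z * norm ?z = blinfun_apply A ?z \<bullet> y"
    by (metis inner_adjoint_blinfun power2_eq_square power2_norm_eq_inner)
  also have "\<dots> \<le> norm (blinfun_apply A ?z) * norm y" by (rule norm_cauchy_schwarz)
  also have "\<dots> \<le> (norm A * norm y) * norm ?z"
    using mult_right_mono[OF norm_blinfun[of A ?z] norm_ge_zero[of y]]
    by (simp add: mult_ac)
  finally have square: "norm ?z * norm ?z \<le> (norm A * norm y) * norm ?z" .
  show ?thesis
  proof (cases "?z = 0")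
    case False
    then show ?thesis using mult_right_le_imp_le[OF square] by simp
  qed simp
qed

section \<open>The iteration under the tangential cone condition\<close>

locale landweber_tangential_cone =
  fixes F :: "'u::{real_inner,complete_space} \<Rightarrow> 'y::{real_inner,complete_space}"
    and G :: "'u \<Rightarrow> 'u \<Rightarrow>\<^sub>L 'y"
    and u_dag u0 :: 'u
    and L \<rho> \<mu> lam Lam :: real
    and w :: "nat \<Rightarrow> real"
  assumes G_bound: "\<And>u. u \<in> cball u_dag \<rho> \<Longrightarrow> norm (G u) \<le> L"
    and radius_nonneg: "0 \<le> \<rho>"
    and mu_nonneg: "0 \<le> \<mu>" and mu_less_1: "\<mu> < 1"
    and cone: "\<And>u v. u \<in> cball u_dag \<rho> \<Longrightarrow> v \<in> cball u_dag \<rho> \<Longrightarrow>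
           norm (F v - F u - blinfun_apply (G u) (v - u)) \<le> \<mu> * norm (F v - F u)"
    and lam_pos: "0 < lam"
    and step_bound: "2 - 2 * \<mu> - Lam * L\<^sup>2 > 0"
    and start: "u0 \<in> cball u_dag \<rho>"
    and step_ge: "\<And>n. lam \<le> w n" and step_le: "\<And>n. w n \<le> Lam"
begin

abbreviation u :: "nat \<Rightarrow> 'u" where
  "u \<equiv> landweber F G (F u_dag) w u0"

definition residual :: "nat \<Rightarrow> 'y" where
  "residual n = F u_dag - F (u n)"

definition sq_error :: "nat \<Rightarrow> real" where
  "sq_error n = (norm (u n - u_dag))\<^sup>2"

definition decrease_const :: real where
  "decrease_const = lam * (2 - 2 * \<mu> - Lam * L\<^sup>2)"

lemma decrease_const_pos: "decrease_const > 0"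
  unfolding decrease_const_def using lam_pos step_bound by simp

lemma step_pos: "w n > 0"
  using lam_pos step_ge[of n] by linarith

lemma Lam_nonneg: "Lam \<ge> 0"
  using step_pos[of 0] step_le[of 0] by linarith

lemma u_dag_in_ball: "u_dag \<in> cball u_dag \<rho>"
  using radius_nonneg by simp

lemma norm_G_apply_le:
  assumes "p \<in> cball u_dag \<rho>" "q \<in> cball u_dag \<rho>"
  shows "norm (blinfun_apply (G p) (q - p)) \<le> (1 + \<mu>) * norm (F q - F p)"
proof -
  have "norm (blinfun_apply (G p) (q - p)) \<le>
      norm (F q - F p) + norm (F q - F p - blinfun_apply (G p) (q - p))"
    by (metis norm_triangle_sub norm_minus_commute)
  then show ?thesis using cone[OF assms] by (simp add: algebra_simps)
qed

lemma F_lipschitz: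
  assumes "p \<in> cball u_dag \<rho>" "q \<in> cball u_dag \<rho>"
  shows "norm (F q - F p) \<le> L / (1 - \<mu>) * norm (q - p)"
proof -
  have "norm (F q - F p) \<le> norm (blinfun_apply (G p) (q - p)) +
      norm (F q - F p - blinfun_apply (G p) (q - p))"
    by (rule norm_triangle_sub)
  also have "\<dots> \<le> L * norm (q - p) + \<mu> * norm (F q - F p)"
    using norm_blinfun[of "G p" "q - p"] mult_right_mono[OF G_bound[OF assms(1)], of "norm (q - p)"]
      cone[OF assms] by simp
  finally show ?thesis using mu_less_1 by (simp add: field_simps)
qed

text \<open>
  Expanding the square, the mixed term is
  \<open>- 2 w\<^sub>n r\<^sub>n \<bullet> G u\<^sub>n (u_dag - u\<^sub>n)\<close>, which the cone condition bounds by
  \<open>- 2 w\<^sub>n (1 - \<mu>) \<parallel>r\<^sub>n\<parallel>\<^sup>2\<close>, while the quadratic term is at most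
  \<open>w\<^sub>n\<^sup>2 L\<^sup>2 \<parallel>r\<^sub>n\<parallel>\<^sup>2\<close>.
\<close>

lemma error_decrease:
  assumes ball: "u n \<in> cball u_dag \<rho>"
  shows "decrease_const * (norm (residual n))\<^sup>2 \<le> sq_error n - sq_error (Suc n)"
proof -
  let ?r = "residual n" and ?e = "u n - u_dag"
  let ?s = "adjoint (blinfun_apply (G (u n))) ?r"
  have "sq_error (Suc n) = (norm (?e + w n *\<^sub>R ?s))\<^sup>2"
    by (simp add: sq_error_def residual_def algebra_simps)
  also have "\<dots> = sq_error n + 2 * w n * (?e \<bullet> ?s) + (w n)\<^sup>2 * (norm ?s)\<^sup>2"
    unfolding sq_error_def power2_norm_eq_inner
    by (simp add: inner_commute power2_eq_square algebra_simps)
  finally have expand: "sq_error (Suc n) = \<dots>" .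
  have "?e \<bullet> ?s = ?r \<bullet> (?r - blinfun_apply (G (u n)) (u_dag - u n)) - (norm ?r)\<^sup>2"
    unfolding inner_adjoint_blinfun power2_norm_eq_inner
    by (simp add: blinfun.diff_right inner_commute algebra_simps)
  also have "?r \<bullet> (?r - blinfun_apply (G (u n)) (u_dag - u n)) \<le> norm ?r * (\<mu> * norm ?r)"
    using norm_cauchy_schwarz[of ?r "?r - blinfun_apply (G (u n)) (u_dag - u n)"]
      mult_left_mono[OF cone[OF ball u_dag_in_ball] norm_ge_zero[of ?r]]
    by (simp add: residual_def)
  finally have mixed: "?e \<bullet> ?s \<le> - (1 - \<mu>) * (norm ?r)\<^sup>2"
    by (simp add: power2_eq_square algebra_simps)
  have "norm ?s \<le> L * norm ?r"
    using norm_adjoint_blinfun_le[of "G (u n)" ?r] mult_right_mono[OF G_bound[OF ball], of "norm ?r"]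
    by simp
  then have quad: "(norm ?s)\<^sup>2 \<le> L\<^sup>2 * (norm ?r)\<^sup>2"
    by (metis norm_ge_zero power_mono power_mult_distrib)
  have "sq_error (Suc n) \<le>
      sq_error n + 2 * w n * (- (1 - \<mu>) * (norm ?r)\<^sup>2) + (w n)\<^sup>2 * (L\<^sup>2 * (norm ?r)\<^sup>2)"
    unfolding expand using mixed quad step_pos[of n]
    by (intro add_mono mult_left_mono) auto
  also have "\<dots> = sq_error n - w n * (2 - 2 * \<mu> - w n * L\<^sup>2) * (norm ?r)\<^sup>2"
    by (simp add: power2_eq_square algebra_simps)
  also have "\<dots> \<le> sq_error n - decrease_const * (norm ?r)\<^sup>2"
  proof -
    have "w n * L\<^sup>2 \<le> Lam * L\<^sup>2" using step_le by (intro mult_right_mono) auto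
    then have "decrease_const \<le> w n * (2 - 2 * \<mu> - w n * L\<^sup>2)"
      unfolding decrease_const_def using step_ge[of n] step_pos[of n] step_bound
      by (intro mult_mono) auto
    then show ?thesis by (simp add: mult_right_mono)
  qed
  finally show ?thesis by linarith
qed

lemma iterate_in_ball: "u n \<in> cball u_dag \<rho>"
proof (induction n)
  case 0
  then show ?case using start by simp
next
  case (Suc n)
  have "0 \<le> decrease_const * (norm (residual n))\<^sup>2" using decrease_const_pos by simp
  then have "sq_error (Suc n) \<le> sq_error n" using error_decrease[OF Suc.IH] by linarith
  then have "norm (u (Suc n) - u_dag) \<le> norm (u n - u_dag)"
    unfolding sq_error_def by (rule power2_le_imp_le) simp
  then show ?case using Suc.IH by (simp add: dist_norm norm_minus_commute)
qed

lemma sum_residual_le: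
  assumes "m \<le> n"
  shows "decrease_const * (\<Sum>i=m..<n. (norm (residual i))\<^sup>2) \<le> sq_error m - sq_error n"
proof -
  have "decrease_const * (\<Sum>i=m..<n. (norm (residual i))\<^sup>2)
      \<le> (\<Sum>i=m..<n. sq_error i - sq_error (Suc i))"
    unfolding sum_distrib_left
    using error_decrease[OF iterate_in_ball] by (intro sum_mono)
  also have "\<dots> = sq_error m - sq_error n"
    using sum_Suc_diff'[OF assms, of "\<lambda>i. - sq_error i"] by simp
  finally show ?thesis .
qed

lemma sq_error_decseq: "decseq sq_error"
proof (rule decseq_SucI)
  fix n
  have "0 \<le> decrease_const * (norm (residual n))\<^sup>2" using decrease_const_pos by simp
  then show "sq_error (Suc n) \<le> sq_error n"
    using error_decrease[OF iterate_in_ball, of n] by linarith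
qed

lemma sq_error_convergent: "convergent sq_error"
proof (rule decseq_convergent[OF sq_error_decseq])
  show "\<forall>i. 0 \<le> sq_error i" by (simp add: sq_error_def)
qed (auto simp: convergent_def)

lemma residual_tendsto_0: "residual \<longlonglongrightarrow> 0"
proof -
  obtain a where a: "sq_error \<longlonglongrightarrow> a" using sq_error_convergent by (auto simp: convergent_def)
  then have "(\<lambda>n. (sq_error n - sq_error (Suc n)) / decrease_const) \<longlonglongrightarrow> (a - a) / decrease_const"
    using decrease_const_pos by (intro tendsto_intros LIMSEQ_Suc) auto
  then have lim: "(\<lambda>n. (sq_error n - sq_error (Suc n)) / decrease_const) \<longlonglongrightarrow> 0" by simp
  have "(\<lambda>n. (norm (residual n))\<^sup>2) \<longlonglongrightarrow> 0"
  proof (rule tendsto_sandwich[OF _ _ tendsto_const lim])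
    show "\<forall>\<^sub>F n in sequentially.
        (norm (residual n))\<^sup>2 \<le> (sq_error n - sq_error (Suc n)) / decrease_const"
      using error_decrease[OF iterate_in_ball] decrease_const_pos
      by (intro always_eventually allI) (simp add: field_simps)
  qed simp
  from tendsto_real_sqrt[OF this] show ?thesis by (simp add: tendsto_norm_zero_iff)
qed

section \<open>Strong convergence\<close>

text \<open>
  Moving the adjoint to the other side turns the \<open>i\<close>-th summand into
  \<open>r\<^sub>i \<bullet> G u\<^sub>i (u_dag - u\<^sub>l)\<close>. With
  \<open>u_dag - u\<^sub>l = (u_dag - u\<^sub>i) - (u\<^sub>l - u\<^sub>i)\<close> both parts start at \<open>u\<^sub>i\<close>, so
  the cone condition applies to each: the first costs \<open>\<parallel>r\<^sub>i\<parallel>\<close>, the second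
  \<open>\<parallel>r\<^sub>i - r\<^sub>l\<parallel> \<le> 2 \<parallel>r\<^sub>i\<parallel>\<close>, whence the factor \<open>3\<close>.
\<close>

lemma step_inner_error_le:
  assumes min: "norm (residual l) \<le> norm (residual i)"
  shows "\<bar>(u (Suc i) - u i) \<bullet> (u_dag - u l)\<bar> \<le> 3 * (1 + \<mu>) * Lam * (norm (residual i))\<^sup>2"
proof -
  let ?G = "blinfun_apply (G (u i))" and ?r = "norm (residual i)"
  have "norm (?G (u_dag - u l)) = norm (?G (u_dag - u i) - ?G (u l - u i))"
    by (simp add: blinfun.diff_right)
  also have "\<dots> \<le> norm (?G (u_dag - u i)) + norm (?G (u l - u i))"
    by (rule norm_triangle_ineq4)
  also have "\<dots> \<le> (1 + \<mu>) * ?r + (1 + \<mu>) * norm (F (u l) - F (u i))"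
    using norm_G_apply_le[OF iterate_in_ball u_dag_in_ball, of i]
      norm_G_apply_le[OF iterate_in_ball iterate_in_ball, of i l]
    by (simp add: residual_def)
  also have "\<dots> \<le> (1 + \<mu>) * ?r + (1 + \<mu>) * (2 * ?r)"
  proof -
    have "norm (F (u l) - F (u i)) \<le> ?r + norm (residual l)"
      using norm_triangle_ineq4[of "residual i" "residual l"] by (simp add: residual_def)
    then show ?thesis using min mu_nonneg by (intro add_left_mono mult_left_mono) auto
  qed
  finally have G_le: "norm (?G (u_dag - u l)) \<le> 3 * (1 + \<mu>) * ?r" by (simp add: algebra_simps)
  have "\<bar>(u (Suc i) - u i) \<bullet> (u_dag - u l)\<bar> = w i * \<bar>?G (u_dag - u l) \<bullet> residual i\<bar>"
    using step_pos[of i]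
    by (simp add: inner_commute[of _ "u_dag - u l"] inner_adjoint_blinfun abs_mult residual_def)
  also have "\<dots> \<le> Lam * ((3 * (1 + \<mu>) * ?r) * ?r)"
    using step_le[of i] Lam_nonneg Cauchy_Schwarz_ineq2[of "?G (u_dag - u l)" "residual i"]
      mult_right_mono[OF G_le norm_ge_zero[of "residual i"]]
    by (intro mult_mono) auto
  finally show ?thesis by (simp add: power2_eq_square mult_ac)
qed

lemma segment_inner_error_le:
  assumes "p \<le> q" and min: "\<And>i. i \<in> {p..<q} \<Longrightarrow> norm (residual l) \<le> norm (residual i)"
  shows "\<bar>(u q - u p) \<bullet> (u_dag - u l)\<bar>
    \<le> 3 * (1 + \<mu>) * Lam / decrease_const * (sq_error p - sq_error q)"
proof -
  have "(u q - u p) \<bullet> (u_dag - u l) = (\<Sum>i=p..<q. (u (Suc i) - u i) \<bullet> (u_dag - u l))"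
    by (subst sum_Suc_diff'[OF assms(1), symmetric]) (rule inner_sum_left)
  then have "\<bar>(u q - u p) \<bullet> (u_dag - u l)\<bar>
      \<le> (\<Sum>i=p..<q. \<bar>(u (Suc i) - u i) \<bullet> (u_dag - u l)\<bar>)"
    by (simp only: sum_abs)
  also have "\<dots> \<le> 3 * (1 + \<mu>) * Lam * (\<Sum>i=p..<q. (norm (residual i))\<^sup>2)"
    unfolding sum_distrib_left by (intro sum_mono step_inner_error_le min)
  also have "\<dots> \<le> 3 * (1 + \<mu>) * Lam * ((sq_error p - sq_error q) / decrease_const)"
    using sum_residual_le[OF assms(1)] decrease_const_pos mu_nonneg Lam_nonneg
    by (intro mult_left_mono) (simp_all add: field_simps)
  finally show ?thesis by simp
qed

definition cauchy_const :: real where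
  "cauchy_const = 1 + 6 * (1 + \<mu>) * Lam / decrease_const"

lemma cauchy_const_pos: "cauchy_const > 0"
  unfolding cauchy_const_def using mu_nonneg Lam_nonneg decrease_const_pos
  by (intro add_pos_nonneg) auto

text \<open>
  By the polarisation identity
  \<open>\<parallel>u\<^sub>j - u\<^sub>l\<parallel>\<^sup>2 = a\<^sub>j - a\<^sub>l + 2 (u\<^sub>j - u\<^sub>l) \<bullet> (u_dag - u\<^sub>l)\<close>, and both terms are
  controlled by the drop of the error over \<open>m, \<dots>, n\<close> when \<open>l\<close> has the smallest residual there.
\<close>

lemma dist_square_to_min_residual_le:
  assumes "l \<in> {m..n}" "j \<in> {m..n}"
    and min: "\<And>i. i \<in> {m..n} \<Longrightarrow> norm (residual l) \<le> norm (residual i)"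
  shows "(norm (u j - u l))\<^sup>2 \<le> cauchy_const * (sq_error m - sq_error n)"
proof -
  let ?K = "3 * (1 + \<mu>) * Lam / decrease_const" and ?D = "sq_error m - sq_error n"
  have K: "?K \<ge> 0" using mu_nonneg Lam_nonneg decrease_const_pos by simp
  have drop: "sq_error p - sq_error q \<le> ?D" if "p \<in> {m..n}" "q \<in> {m..n}" for p q
    using that decseqD[OF sq_error_decseq, of m p] decseqD[OF sq_error_decseq, of q n] by auto
  have "\<bar>(u j - u l) \<bullet> (u_dag - u l)\<bar> \<le> ?K * ?D"
  proof (cases "l \<le> j")
    case True
    then have "\<bar>(u j - u l) \<bullet> (u_dag - u l)\<bar> \<le> ?K * (sq_error l - sq_error j)"
      using assms by (intro segment_inner_error_le) auto
    also have "\<dots> \<le> ?K * ?D" using drop assms K by (intro mult_left_mono) auto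
    finally show ?thesis .
  next
    case False
    then have "\<bar>(u l - u j) \<bullet> (u_dag - u l)\<bar> \<le> ?K * (sq_error j - sq_error l)"
      using assms by (intro segment_inner_error_le) auto
    also have "\<dots> \<le> ?K * ?D" using drop assms K by (intro mult_left_mono) auto
    finally show ?thesis by (simp add: inner_diff_left abs_minus_commute)
  qed
  moreover have "(norm (u j - u l))\<^sup>2
      = sq_error j - sq_error l + 2 * ((u j - u l) \<bullet> (u_dag - u l))"
    unfolding sq_error_def power2_norm_eq_inner by (simp add: inner_commute algebra_simps)
  ultimately have "(norm (u j - u l))\<^sup>2 \<le> ?D + 2 * (?K * ?D)"
    using drop[OF assms(2,1)] by linarith
  also have "\<dots> = cauchy_const * ?D" by (simp add: cauchy_const_def algebra_simps)
  finally show ?thesis .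
qed

lemma dist_square_le_error_drop:
  assumes "m \<le> n"
  shows "(norm (u m - u n))\<^sup>2 \<le> 4 * cauchy_const * (sq_error m - sq_error n)"
proof -
  define l where "l = arg_min_on (\<lambda>i. norm (residual i)) {m..n}"
  have l: "l \<in> {m..n}"
    unfolding l_def using assms by (intro arg_min_if_finite(1)) auto
  have min: "norm (residual l) \<le> norm (residual i)" if "i \<in> {m..n}" for i
    unfolding l_def using assms that by (intro arg_min_least) auto
  have "(norm (u m - u n))\<^sup>2 \<le> (norm (u m - u l) + norm (u n - u l))\<^sup>2"
    using norm_triangle_ineq4[of "u m - u l" "u n - u l"] by (intro power_mono) simp_all
  also have "\<dots> \<le> 2 * (norm (u m - u l))\<^sup>2 + 2 * (norm (u n - u l))\<^sup>2"
    using sum_squares_bound[of "norm (u m - u l)" "norm (u n - u l)"]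
    by (simp add: power2_sum)
  also have "\<dots> \<le> 4 * cauchy_const * (sq_error m - sq_error n)"
    using dist_square_to_min_residual_le[OF l _ min, of m]
      dist_square_to_min_residual_le[OF l _ min, of n] assms by simp
  finally show ?thesis .
qed

lemma Cauchy_iterates: "Cauchy u"
proof (rule CauchyI')
  fix e :: real assume "e > 0"
  define d where "d = e\<^sup>2 / (4 * cauchy_const)"
  have "d > 0" using \<open>e > 0\<close> cauchy_const_pos by (simp add: d_def)
  moreover have "Cauchy sq_error" using sq_error_convergent by (rule convergent_Cauchy)
  ultimately obtain M where M: "\<And>m n. m \<ge> M \<Longrightarrow> n \<ge> M \<Longrightarrow> norm (sq_error m - sq_error n) < d"
    by (meson CauchyD)
  show "\<exists>M. \<forall>m\<ge>M. \<forall>n>m. dist (u m) (u n) < e"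
  proof (intro exI allI impI)
    fix m n assume "m \<ge> M" "m < n"
    then have "(norm (u m - u n))\<^sup>2 \<le> 4 * cauchy_const * (sq_error m - sq_error n)"
      by (intro dist_square_le_error_drop) simp
    also have "\<dots> < 4 * cauchy_const * d"
      using M[of m n] \<open>m \<ge> M\<close> \<open>m < n\<close> cauchy_const_pos by (intro mult_strict_left_mono) auto
    also have "\<dots> = e\<^sup>2" using cauchy_const_pos by (simp add: d_def)
    finally show "dist (u m) (u n) < e"
      using \<open>e > 0\<close> by (simp add: dist_norm power2_less_imp_less)
  qed
qed

theorem iterates_converge_to_solution:
  "\<exists>z\<in>solution_set F (F u_dag) u_dag \<rho>. u \<longlonglongrightarrow> z"
proof -
  obtain z where z: "u \<longlonglongrightarrow> z"
    using Cauchy_iterates Cauchy_convergent convergent_def by blast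
  have z_ball: "z \<in> cball u_dag \<rho>"
    using closed_sequentially[OF closed_cball _ z] iterate_in_ball by blast
  have "(\<lambda>n. L / (1 - \<mu>) * norm (u n - z)) \<longlonglongrightarrow> L / (1 - \<mu>) * norm (z - z)"
    by (intro tendsto_intros z)
  then have lim: "(\<lambda>n. L / (1 - \<mu>) * norm (u n - z)) \<longlonglongrightarrow> 0" by simp
  have "(\<lambda>n. F (u n) - F z) \<longlonglongrightarrow> 0"
    by (rule Lim_null_comparison[OF _ lim])
      (intro always_eventually allI F_lipschitz z_ball iterate_in_ball)
  from tendsto_add[OF this residual_tendsto_0] have "(\<lambda>n. F u_dag - F z) \<longlonglongrightarrow> 0"
    by (simp add: residual_def)
  then have "F z = F u_dag" by (simp add: LIMSEQ_const_iff)
  then show ?thesis using z z_ball by (auto simp: solution_set_def)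
qed

end

theorem theorem2p3:
  fixes F :: "'u::{real_inner,complete_space} \<Rightarrow> 'y::{real_inner,complete_space}"
    and G :: "'u \<Rightarrow> 'u \<Rightarrow>\<^sub>L 'y"
    and u_dag u0 :: 'u
    and y_dag :: 'y
    and L \<rho>0 \<rho> \<mu> lam Lam :: real
    and w :: "nat \<Rightarrow> real"
  assumes "y_dag = F u_dag"
    and "L > 0" and "\<rho>0 > 0"
    and "\<forall>u\<in>cball u_dag \<rho>0. norm (G u) \<le> L"
    and "0 < \<rho>" and "\<rho> \<le> \<rho>0"
    and "0 \<le> \<mu>" and "\<mu> < 1"
    and "\<forall>u\<in>cball u_dag \<rho>. \<forall>v\<in>cball u_dag \<rho>.
           norm (F v - F u - blinfun_apply (G u) (v - u)) \<le> \<mu> * norm (F v - F u)"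
    and "0 < lam" and "lam \<le> Lam"
    and "2 - 2 * \<mu> - Lam * L\<^sup>2 > 0"
    and "u0 \<in> cball u_dag \<rho>"
    and "\<forall>n. w n \<in> {lam..Lam}"
  shows "(\<exists>N. stops_at F y_dag (landweber F G y_dag w u0) N
              \<and> landweber F G y_dag w u0 N \<in> solution_set F y_dag u_dag \<rho>)
       \<or> ((\<nexists>N. stops_at F y_dag (landweber F G y_dag w u0) N)
          \<and> (\<exists>u\<in>solution_set F y_dag u_dag \<rho>. landweber F G y_dag w u0 \<longlonglongrightarrow> u))"
proof -
  interpret landweber_tangential_cone F G u_dag u0 L \<rho> \<mu> lam Lam w
    using assms by unfold_locales auto
  show ?thesis
    using iterate_in_ball iterates_converge_to_solution \<open>y_dag = F u_dag\<close>
    by (auto simp: stops_at_def solution_set_def)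
qed

end
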